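(* The proportion of good vertices in the graph $B(k)$ tends to $\frac25$ as $k$ tends to infinity.
   Context: All graphs are finite and simple. For a connected graph $G=(V,E)$, $d_G(x,y)$ denotes the length of a shortest path from $x$ to $y$, and the Wiener index is $W(G)=\frac12\sum_{u,v\in V,\,u\neq v} d_G(u,v)$ (the sum over ordered pairs, so each unordered pair of distinct vertices contributes its distance once). $G-v$ is the graph obtained from $G$ by removing the vertex $v$. A vertex $v\in V$ is called good if $G-v$ is connected and $W(G)=W(G-v)$. The proportion of good vertices in $G$ is the number of good vertices of $G$ divided by $|V|$. Definition of $B(k)$ for $k\in\mathbb{N}$, $k>1$: take a path of length $5$ with consecutive vertices $w_0,w_1,w_2,w_3,w_4,w_5$. Take $k$ pairwise disjoint paths $(v_{i1},v_{i2},v_{i3},v_{i4},v_{i5})$, $i\in\{1,\dots,k\}$, also disjoint from the first path. For each $i\in\{1,\dots,k\}$ add the edges $\{w_0,v_{i1}\}$ and $\{w_5,v_{i5}\}$. The resulting graph $B(k)$ has $5k+6$ vertices. *)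

theory Defs
  imports Complex_Main "Graph_Theory.Graph_Theory"
begin

text \<open>
  A finite simple graph is represented by a digraph satisfying the locale \<^locale>\<open>graph\<close>
  (finite, loop-free, without parallel arcs, and with a symmetric arc relation); each edge
  corresponds to two opposite arcs.
\<close>

text \<open>An \<open>apath\<close> is the list of its arcs, so \<^const>\<open>length\<close> counts edges. If there is no path
  from \<open>x\<close> to \<open>y\<close>, then \<open>gdist G x y\<close> is meaningless (it is \<open>0\<close>).\<close>

definition gdist :: "('a, 'b) pre_digraph \<Rightarrow> 'a \<Rightarrow> 'a \<Rightarrow> nat" where
  "gdist G x y = (INF p \<in> {p. pre_digraph.apath G x p y}. length p)"

definition wiener :: "('a, 'b) pre_digraph \<Rightarrow> real" where
  "wiener G = 1/2 * (\<Sum>(u, v) \<in> {(u, v). u \<in> verts G \<and> v \<in> verts G \<and> u \<noteq> v}. real (gdist G u v))"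

text \<open>The constant \<open>connected\<close> is qualified because the topological notion has the same base name.\<close>

definition good_vertex :: "('a, 'b) pre_digraph \<Rightarrow> 'a \<Rightarrow> bool" where
  "good_vertex G v \<longleftrightarrow> v \<in> verts G
     \<and> Digraph_Component.connected (pre_digraph.del_vert G v)
     \<and> wiener G = wiener (pre_digraph.del_vert G v)"

definition good_proportion :: "('a, 'b) pre_digraph \<Rightarrow> real" where
  "good_proportion G = real (card {v. good_vertex G v}) / real (card (verts G))"

datatype bvertex = Wv nat | Vv nat nat

definition B_verts :: "nat \<Rightarrow> bvertex set" where
  "B_verts k = {Wv j | j. j \<le> 5} \<union> {Vv i j | i j. i \<in> {1..k} \<and> j \<in> {1..5}}"

text \<open>One orientation of each edge.\<close>

definition B_half :: "nat \<Rightarrow> bvertex rel" where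
  "B_half k =
     {(Wv j, Wv (j + 1)) | j. j < 5}
   \<union> {(Vv i j, Vv i (j + 1)) | i j. i \<in> {1..k} \<and> j \<in> {1..<5}}
   \<union> {(Wv 0, Vv i 1) | i. i \<in> {1..k}}
   \<union> {(Wv 5, Vv i 5) | i. i \<in> {1..k}}"

definition B :: "nat \<Rightarrow> bvertex pair_pre_digraph" where
  "B k = \<lparr> pverts = B_verts k, parcs = B_half k \<union> (B_half k)\<inverse> \<rparr>"

text \<open>For reachable vertices, \<open>gdist\<close> agrees with the weighted shortest-path distance
  of the library for unit weights.\<close>

lemma (in wf_digraph) mu_unit_eq_gdist:
  assumes "u \<rightarrow>\<^sup>* v"
  shows "\<mu> (\<lambda>_. 1) u v = ereal (real (gdist G u v))"
proof -
  have cost: "awalk_cost (\<lambda>_. 1) p = real (length p)" for p :: "'b list"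
    by (induction p) auto
  let ?P = "{p. apath u p v}"
  have ne: "?P \<noteq> {}"
    using assms by (simp add: reachable_apath)
  then have "(INF p\<in>?P. length p) \<in> length ` ?P"
    by (intro Inf_nat_def1) simp
  then obtain p where p: "apath u p v" "length p = gdist G u v"
    by (auto simp: gdist_def)
  have least: "gdist G u v \<le> length q" if "awalk u q v" for q
  proof -
    have "apath u (awalk_to_apath q) v"
      using that by (rule apath_awalk_to_apath)
    then have "gdist G u v \<le> length (awalk_to_apath q)"
      unfolding gdist_def by (intro cINF_lower) auto
    also have "\<dots> \<le> length q"
      using awalk_to_path_no_neg_cyc_cost[OF that, of "\<lambda>_. 1"] by (simp add: cost)
    finally show ?thesis .
  qed
  show ?thesis
    unfolding \<mu>_def cost
  proof (rule antisym)
    show "(INF q\<in>{q. awalk u q v}. ereal (real (length q))) \<le> ereal (real (gdist G u v))"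
      using p by (intro INF_lower2[of p]) (auto simp: awalkI_apath)
    show "ereal (real (gdist G u v)) \<le> (INF q\<in>{q. awalk u q v}. ereal (real (length q)))"
      using least by (intro INF_greatest) auto
  qed
qed

lemma finite_B_verts: "finite (B_verts k)"
proof -
  have "B_verts k = Wv ` {..5} \<union> case_prod Vv ` ({1..k} \<times> {1..5})"
    by (auto simp: B_verts_def)
  then show ?thesis by simp
qed

lemma card_B_verts: "card (B_verts k) = 5 * k + 6"
proof -
  have "B_verts k = Wv ` {..5} \<union> case_prod Vv ` ({1..k} \<times> {1..5})"
    by (auto simp: B_verts_def)
  moreover have "card (Wv ` {..5}) = 6"
    by (simp add: card_image inj_on_def)
  moreover have "card (case_prod Vv ` ({1..k} \<times> {1..5})) = 5 * k"
    by (subst card_image) (auto simp: inj_on_def)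
  moreover have "Wv ` {..5} \<inter> case_prod Vv ` ({1..k} \<times> {1..5}) = {}"
    by auto
  ultimately show ?thesis
    by (simp add: card_Un_disjoint)
qed

lemma pair_graph_B: "pair_graph (B k)"
proof -
  have sub: "B_half k \<subseteq> B_verts k \<times> B_verts k"
    by (auto simp: B_half_def B_verts_def)
  then have fin: "finite (B_half k)"
    using finite_B_verts by (meson finite_SigmaI finite_subset)
  have irr: "(x, x) \<notin> B_half k" for x
    by (auto simp: B_half_def)
  show ?thesis
    using sub fin irr finite_B_verts
    by unfold_locales (auto simp: B_def symmetric_def intro: symI)
qed

lemma connected_B: "Digraph_Component.connected (B k)"
proof -
  interpret pair_graph "B k" by (rule pair_graph_B)
  have step: "u \<rightarrow>\<^sup>*\<^bsub>with_proj (B k)\<^esub> v" if "(u, v) \<in> parcs (B k)" for u v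
    using that by (simp add: reachable_adjI)
  have W: "Wv 0 \<rightarrow>\<^sup>*\<^bsub>with_proj (B k)\<^esub> Wv j" if "j \<le> 5" for j
    using that
  proof (induction j)
    case 0
    have "Wv 0 \<in> pverts (B k)" by (simp add: B_def B_verts_def)
    then show ?case by simp
  next
    case (Suc j)
    then have "(Wv j, Wv (Suc j)) \<in> parcs (B k)" by (auto simp: B_def B_half_def)
    then show ?case using Suc step reachable_trans by (meson Suc_leD)
  qed
  have V: "Wv 0 \<rightarrow>\<^sup>*\<^bsub>with_proj (B k)\<^esub> Vv i (Suc j)" if "j < 5" "i \<in> {1..k}" for i j
    using that
  proof (induction j)
    case 0
    then have "(Wv 0, Vv i (Suc 0)) \<in> parcs (B k)" by (auto simp: B_def B_half_def)
    then show ?case by (rule step)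
  next
    case (Suc j)
    then have "(Vv i (Suc j), Vv i (Suc (Suc j))) \<in> parcs (B k)" by (auto simp: B_def B_half_def)
    then show ?case using Suc step reachable_trans by (meson Suc_lessD)
  qed
  have all: "Wv 0 \<rightarrow>\<^sup>*\<^bsub>with_proj (B k)\<^esub> x" if x: "x \<in> pverts (B k)" for x
  proof (cases x)
    case (Wv j)
    with x have "j \<le> 5" by (auto simp: B_def B_verts_def)
    with Wv W show ?thesis by simp
  next
    case (Vv i j)
    with x have "i \<in> {1..k}" "j - 1 < 5" "j = Suc (j - 1)"
      by (auto simp: B_def B_verts_def)
    with V[of "j - 1" i] Vv show ?thesis by simp
  qed
  have "strongly_connected (with_proj (B k))"
    unfolding strongly_connected_def
  proof (intro conjI ballI)
    show "verts (with_proj (B k)) \<noteq> {}" by (auto simp: B_def B_verts_def)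
  next
    fix x y assume "x \<in> verts (with_proj (B k))" "y \<in> verts (with_proj (B k))"
    then show "x \<rightarrow>\<^sup>*\<^bsub>with_proj (B k)\<^esub> y"
      using all symmetric_reachable[OF sym_arcs] reachable_trans by (metis with_proj_simps(1))
  qed
  moreover have "mk_symmetric (with_proj (B k)) = B k"
    by (auto simp: mk_symmetric_def B_def)
  ultimately show ?thesis
    by (simp add: Digraph_Component.connected_def)
qed

end

theory Submission
  imports Defs "HOL-Real_Asymp.Real_Asymp"
begin

text \<open>
  Call \<open>w\<^sub>0\<close> and \<open>w\<^sub>5\<close> the hubs of \<^term>\<open>B k\<close>: the graph is the path of length 5 between
  them together with \<open>k\<close> disjoint detours of length 6. Six of the vertices lie on the short path, so
  their contribution to the proportion vanishes in the limit, and it suffices to decide which of the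
  five vertices of a detour are good.

  Deleting the \<open>j\<close>-th vertex of a detour leaves two tails, one hanging at each hub. Distances
  between vertices off that detour stay as they were, because the short path is shorter than any detour.
  So the change of the Wiener index is the sum of the distances to the deleted vertex, minus
  the growth of the distances to the vertices of the two tails. Both are of the form constant plus
  a multiple of the number \<open>k - 1\<close> of the other detours, and summing up gives
  \<open>W(G) - W(G - v) = c\<^sub>j (k - 1)\<close> with \<open>c\<^sub>1, \<dots>, c\<^sub>5 = 0, 15, 20, 15, 0\<close> (lemma \<open>wiener_diff_value\<close>).
  Hence for \<open>k \<ge> 2\<close> exactly the two end vertices of each detour are good, and the
  number of good vertices lies between \<open>2 k\<close> and \<open>2 k + 6\<close>, out of \<open>5 k + 6\<close>.

  All distances come from one formula, \<open>cut_dist\<close>: two vertices on a common segment (the short path,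
  an intact detour or a tail) are as far apart as their positions say, and any others are
  joined through the better one of the two hubs. The formula is
  proved for the graph with a deleted vertex only; the intact graph is the case where the vertex to be
  deleted belongs to a detour that does not exist. The upper bound exhibits
  walks (lemma \<open>walk_cut_dist\<close>); the lower bound holds as the formula changes by at most one along every
  edge (lemma \<open>cut_dist_half\<close>).
\<close>

section \<open>Recognising a distance function\<close>

lemma (in wf_digraph) awalk_of_relpow:
  assumes "(x, y) \<in> arcs_ends G ^^ n" "x \<in> verts G"
  shows "\<exists>p. awalk x p y \<and> length p = n"
  using assms
proof (induction n arbitrary: y)
  case 0 then show ?case by (auto simp: awalk_Nil_iff)
next
  case (Suc n)
  then obtain z where z: "(x, z) \<in> arcs_ends G ^^ n" "z \<rightarrow>\<^bsub>G\<^esub> y" by auto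
  with Suc obtain p where p: "awalk x p z" "length p = n" by blast
  obtain e where "e \<in> arcs G" "tail G e = z" "head G e = y" using z(2) by blast
  then have "awalk z [e] y" using arc_implies_awalk by blast
  with p have "awalk x (p @ [e]) y" by auto
  with p show ?case by (intro exI[of _ "p @ [e]"]) auto
qed

text \<open>A function that vanishes at \<open>x\<close> and grows by at most one along each arc bounds the length of
  every walk from \<open>x\<close> from below; a single walk attaining the bound then settles the distance.\<close>

lemma (in wf_digraph) gdist_eqI:
  fixes D :: "'a \<Rightarrow> nat"
  assumes x: "x \<in> verts G" "D x = 0"
    and lip: "\<And>u v. u \<rightarrow>\<^bsub>G\<^esub> v \<Longrightarrow> D v \<le> Suc (D u)"
    and walk: "(x, y) \<in> arcs_ends G ^^ D y"
  shows "gdist G x y = D y"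
proof -
  have lower: "D v \<le> D u + length p" if "awalk u p v" for u p v
    using that
  proof (induction p arbitrary: u)
    case Nil then show ?case by (simp add: awalk_Nil_iff)
  next
    case (Cons e p)
    then have e: "e \<in> arcs G" "u = tail G e" "awalk (head G e) p v"
      by (auto simp: awalk_Cons_iff)
    then have "D (head G e) \<le> Suc (D u)" by (auto intro!: lip in_arcs_imp_in_arcs_ends)
    with Cons.IH[OF e(3)] show ?case by simp
  qed
  obtain p where p: "awalk x p y" "length p = D y"
    using awalk_of_relpow[OF walk x(1)] by blast
  then have r: "x \<rightarrow>\<^sup>* y" by (auto simp: reachable_awalk)
  \<comment> \<open>Removing the cycles of a walk does not lengthen it, by the fact on costs taken with unit weights.\<close>
  have cost: "awalk_cost (\<lambda>_. 1) p = real (length p)" for p :: "'b list"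
    by (induction p) auto
  have "length (awalk_to_apath p) \<le> length p"
    using awalk_to_path_no_neg_cyc_cost[OF p(1), of "\<lambda>_. 1"] by (simp add: cost)
  moreover have "gdist G x y \<le> length (awalk_to_apath p)"
    unfolding gdist_def using apath_awalk_to_apath[OF p(1)] by (intro cINF_lower) auto
  moreover have "D y \<le> gdist G x y"
    unfolding gdist_def using r lower[of x _ y] x(2)
    by (intro cINF_greatest) (auto simp: reachable_apath dest: awalkI_apath)
  ultimately show "gdist G x y = D y" using p by simp
qed

section \<open>The distance formula\<close>

text \<open>For a vertex other than \<open>Vv i j\<close>, this is the distance to the hub \<open>Wv 0\<close> once \<open>Vv i j\<close> is deleted.
  A vertex beyond the cut, at position \<open>a > j\<close> of the \<open>i\<close>-th detour, has to go
  the other way round: \<open>6 - a\<close> steps to the far hub and five more along the short path.\<close>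

fun w0_dist :: "nat \<Rightarrow> nat \<Rightarrow> bvertex \<Rightarrow> nat" where
  "w0_dist i j (Wv a) = a"
| "w0_dist i j (Vv i' a) = (if i' = i \<and> j < a then 11 - a else a)"

fun w5_dist :: "nat \<Rightarrow> nat \<Rightarrow> bvertex \<Rightarrow> nat" where
  "w5_dist i j (Wv a) = 5 - a"
| "w5_dist i j (Vv i' a) = (if i' = i \<and> a < j then 5 + a else 6 - a)"

text \<open>The segments are the short path, each detour, and the two pieces into which the \<open>i\<close>-th detour is cut
  at \<open>j\<close>; \<^const>\<open>None\<close> means that no segment contains both vertices. As natural subtraction
  truncates, \<open>(a - b) + (b - a)\<close> is the absolute difference.\<close>

fun seg_dist :: "nat \<Rightarrow> nat \<Rightarrow> bvertex \<Rightarrow> bvertex \<Rightarrow> nat option" where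
  "seg_dist i j (Wv a) (Wv b) = Some ((a - b) + (b - a))"
| "seg_dist i j (Vv p a) (Vv q b) =
     (if p = q \<and> (p = i \<longrightarrow> (a < j) = (b < j)) then Some ((a - b) + (b - a)) else None)"
| "seg_dist i j _ _ = None"

definition cut_dist :: "nat \<Rightarrow> nat \<Rightarrow> bvertex \<Rightarrow> bvertex \<Rightarrow> nat" where
  "cut_dist i j x y = (case seg_dist i j x y of Some d \<Rightarrow> d
     | None \<Rightarrow> min (w0_dist i j x + w0_dist i j y) (w5_dist i j x + w5_dist i j y))"

text \<open>The indices are not required to name a vertex of \<^term>\<open>B k\<close>: the detours are numbered from 1, so
  \<open>i = 0\<close> gives \<^term>\<open>B k\<close> itself and makes the intact graph an instance of the distance formula.\<close>

definition Bdel :: "nat \<Rightarrow> nat \<Rightarrow> nat \<Rightarrow> (bvertex, bvertex \<times> bvertex) pre_digraph" where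
  "Bdel k i j = pre_digraph.del_vert (with_proj (B k)) (Vv i j)"

lemma verts_Bdel: "verts (Bdel k i j) = B_verts k - {Vv i j}"
  by (simp add: Bdel_def pre_digraph.verts_del_vert B_def)

lemma ends_Bdel:
  "x \<rightarrow>\<^bsub>Bdel k i j\<^esub> y \<longleftrightarrow> ((x, y) \<in> B_half k \<or> (y, x) \<in> B_half k) \<and> x \<noteq> Vv i j \<and> y \<noteq> Vv i j"
  by (auto simp: Bdel_def pre_digraph.del_vert_def B_def arcs_ends_def arc_to_ends_def)

lemma wf_Bdel: "wf_digraph (Bdel k i j)"
proof -
  interpret pair_graph "B k" by (rule pair_graph_B)
  show ?thesis unfolding Bdel_def by (rule wf_digraph_del_vert)
qed

lemma cut_dist_W_W: "cut_dist i j (Wv a) (Wv b) = (a - b) + (b - a)"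
  by (simp add: cut_dist_def)

section \<open>Lower bound: the formula is Lipschitz along edges\<close>

lemma B_half_cases:
  assumes "(u, v) \<in> B_half k"
  obtains (W) b where "b < 5" "u = Wv b" "v = Wv (Suc b)"
    | (V) q b where "1 \<le> b" "b < 5" "u = Vv q b" "v = Vv q (Suc b)"
    | (w0) q where "u = Wv 0" "v = Vv q 1"
    | (w5) q where "u = Wv 5" "v = Vv q 5"
  using assms unfolding B_half_def by auto

lemma hub_dist_half:
  assumes j: "1 \<le> j" "j \<le> 5" and uv: "(u, v) \<in> B_half k" "u \<noteq> Vv i j" "v \<noteq> Vv i j"
  shows "w0_dist i j u \<le> Suc (w0_dist i j v) \<and> w0_dist i j v \<le> Suc (w0_dist i j u) \<and>
    w5_dist i j u \<le> Suc (w5_dist i j v) \<and> w5_dist i j v \<le> Suc (w5_dist i j u)"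
  using uv(1)
proof (cases rule: B_half_cases)
  case (V q b)
  with j uv show ?thesis by (cases "q = i"; cases "b < j") auto
qed (use j uv in auto)

text \<open>If \<open>x\<close> shares a segment with neither end of the edge, the hub distances decide; within a segment the
  positions do. What remains are the edges by which a detour leaves a hub, where the two branches of the formula
  have to agree up to one.\<close>

lemma cut_dist_half:
  assumes j: "1 \<le> j" "j \<le> 5" and uv: "(u, v) \<in> B_half k" "u \<noteq> Vv i j" "v \<noteq> Vv i j"
    and x: "x \<in> B_verts k" "x \<noteq> Vv i j"
  shows "cut_dist i j x v \<le> Suc (cut_dist i j x u) \<and> cut_dist i j x u \<le> Suc (cut_dist i j x v)"
proof (cases "seg_dist i j x u = None \<and> seg_dist i j x v = None")
  case True
  then show ?thesis using hub_dist_half[OF j uv] by (simp add: cut_dist_def; linarith)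
next
  case False
  show ?thesis
    using uv(1)
  proof (cases rule: B_half_cases)
    case (W b)
    with False obtain a where "x = Wv a" by (cases x) auto
    with W show ?thesis by (simp add: cut_dist_W_W; linarith)
  next
    case (V q b)
    with False obtain a where xa: "x = Vv q a" by (cases x) (auto split: if_splits)
    moreover have "(q = i \<longrightarrow> (a < j) = (b < j))" "(q = i \<longrightarrow> (a < j) = (Suc b < j))"
      using False V xa uv by (auto split: if_splits)
    ultimately show ?thesis using V by (simp add: cut_dist_def; linarith)
  next
    case (w0 q)
    show ?thesis
    proof (cases x)
      case (Wv a)
      then have "a \<le> 5" using x by (auto simp: B_verts_def)
      with w0 Wv j uv show ?thesis by (cases "q = i") (simp_all add: cut_dist_def; linarith)+
    next
      case (Vv p a)
      then have "1 \<le> a" "a \<le> 5" using x by (auto simp: B_verts_def)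
      moreover have "p = q" "q = i \<Longrightarrow> a < j" "q = i \<Longrightarrow> 1 < j"
        using False w0 Vv uv j by (auto split: if_splits)
      ultimately show ?thesis using w0 Vv
        by (cases "q = i") (simp_all add: cut_dist_def; linarith)+
    qed
  next
    case (w5 q)
    show ?thesis
    proof (cases x)
      case (Wv a)
      then have "a \<le> 5" using x by (auto simp: B_verts_def)
      with w5 Wv j uv show ?thesis by (cases "q = i") (simp_all add: cut_dist_def; linarith)+
    next
      case (Vv p a)
      then have "1 \<le> a" "a \<le> 5" using x by (auto simp: B_verts_def)
      moreover have "p = q" "q = i \<Longrightarrow> j < a" "q = i \<Longrightarrow> j < 5"
        using False w5 Vv uv x j by (auto split: if_splits)
      ultimately show ?thesis using w5 Vv
        by (cases "q = i") (simp_all add: cut_dist_def; linarith)+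
    qed
  qed
qed

section \<open>Upper bound: walks through a hub or along a segment\<close>

lemma sym_ends_Bdel: "sym (arcs_ends (Bdel k i j))"
  by (rule symI) (auto simp: ends_Bdel)

lemma sym_relpow:
  assumes "sym R" "(x, y) \<in> R ^^ n" shows "(y, x) \<in> R ^^ n"
  using assms(2)
proof (induction n arbitrary: y)
  case (Suc n)
  then obtain z where "(x, z) \<in> R ^^ n" "(z, y) \<in> R" by auto
  with Suc.IH assms(1) show ?case by (meson relpow_Suc_I2 symD)
qed auto

lemma walk_W: "a + n \<le> 5 \<Longrightarrow> (Wv a, Wv (a + n)) \<in> arcs_ends (Bdel k i j) ^^ n"
proof (induction n)
  case (Suc n)
  then have "Wv (a + n) \<rightarrow>\<^bsub>Bdel k i j\<^esub> Wv (a + Suc n)" by (auto simp: ends_Bdel B_half_def)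
  moreover have "(Wv a, Wv (a + n)) \<in> arcs_ends (Bdel k i j) ^^ n"
    using Suc by simp
  ultimately show ?case by (rule relpow_Suc_I[rotated])
qed auto

lemma walk_V:
  assumes "q \<in> {1..k}" "1 \<le> a" "a + n \<le> 5" "q = i \<Longrightarrow> j < a \<or> a + n < j"
  shows "(Vv q a, Vv q (a + n)) \<in> arcs_ends (Bdel k i j) ^^ n"
  using assms(3,4)
proof (induction n)
  case (Suc n)
  then have "Vv q (a + n) \<rightarrow>\<^bsub>Bdel k i j\<^esub> Vv q (a + Suc n)"
    using assms(1,2) by (auto simp: ends_Bdel B_half_def)
  moreover have "(Vv q a, Vv q (a + n)) \<in> arcs_ends (Bdel k i j) ^^ n"
    using Suc by fastforce
  ultimately show ?case by (rule relpow_Suc_I[rotated])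
qed auto

lemma walk_V_w0:
  assumes "q \<in> {1..k}" "b \<in> {1..5}" "q = i \<Longrightarrow> b < j"
  shows "(Vv q b, Wv 0) \<in> arcs_ends (Bdel k i j) ^^ b"
proof -
  have "(Vv q 1, Vv q (1 + (b - 1))) \<in> arcs_ends (Bdel k i j) ^^ (b - 1)"
    using assms by (intro walk_V) auto
  then have "(Vv q b, Vv q 1) \<in> arcs_ends (Bdel k i j) ^^ (b - 1)"
    using assms(2) sym_relpow[OF sym_ends_Bdel] by auto
  moreover have "Vv q 1 \<rightarrow>\<^bsub>Bdel k i j\<^esub> Wv 0" using assms by (auto simp: ends_Bdel B_half_def)
  ultimately have "(Vv q b, Wv 0) \<in> arcs_ends (Bdel k i j) ^^ Suc (b - 1)" by (rule relpow_Suc_I)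
  moreover have "Suc (b - 1) = b" using assms(2) by auto
  ultimately show ?thesis by metis
qed

lemma walk_V_w5:
  assumes "q \<in> {1..k}" "b \<in> {1..5}" "q = i \<Longrightarrow> j < b"
  shows "(Vv q b, Wv 5) \<in> arcs_ends (Bdel k i j) ^^ (6 - b)"
proof -
  have "(Vv q b, Vv q (b + (5 - b))) \<in> arcs_ends (Bdel k i j) ^^ (5 - b)"
    using assms by (intro walk_V) auto
  then have "(Vv q b, Vv q 5) \<in> arcs_ends (Bdel k i j) ^^ (5 - b)"
    using assms(2) by auto
  moreover have "Vv q 5 \<rightarrow>\<^bsub>Bdel k i j\<^esub> Wv 5" using assms by (auto simp: ends_Bdel B_half_def)
  ultimately have "(Vv q b, Wv 5) \<in> arcs_ends (Bdel k i j) ^^ Suc (5 - b)" by (rule relpow_Suc_I)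
  moreover have "Suc (5 - b) = 6 - b" using assms(2) by auto
  ultimately show ?thesis by metis
qed

lemma walk_to_hubs:
  assumes "x \<in> B_verts k" "x \<noteq> Vv i j" "j \<in> {1..5}"
  shows "(x, Wv 0) \<in> arcs_ends (Bdel k i j) ^^ w0_dist i j x"
    and "(x, Wv 5) \<in> arcs_ends (Bdel k i j) ^^ w5_dist i j x"
proof -
  let ?E = "arcs_ends (Bdel k i j)"
  have W05: "(Wv 0, Wv 5) \<in> ?E ^^ 5" using walk_W[of 0 5] by simp
  have W50: "(Wv 5, Wv 0) \<in> ?E ^^ 5" using W05 sym_relpow[OF sym_ends_Bdel] by blast
  have "(x, Wv 0) \<in> ?E ^^ w0_dist i j x \<and> (x, Wv 5) \<in> ?E ^^ w5_dist i j x"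
  proof (cases x)
    case (Wv a)
    then have "a \<le> 5" using assms by (auto simp: B_verts_def)
    then show ?thesis
      using Wv walk_W[of 0 a k i j] walk_W[of a "5 - a" k i j] sym_relpow[OF sym_ends_Bdel] by auto
  next
    case (Vv q b)
    then have b: "q \<in> {1..k}" "b \<in> {1..5}" using assms by (auto simp: B_verts_def)
    consider "q \<noteq> i" | "q = i" "b < j" | "q = i" "j < b" using assms Vv by fastforce
    then show ?thesis
    proof cases
      case 1
      then show ?thesis using Vv walk_V_w0[OF b] walk_V_w5[OF b] by simp
    next
      case 2
      then show ?thesis using Vv walk_V_w0[OF b, of i j] relpow_trans[OF _ W05] by (simp add: add.commute)
    next
      case 3
      then have w5: "(x, Wv 5) \<in> ?E ^^ (6 - b)" using Vv walk_V_w5[OF b, of i j] by simp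
      have "w0_dist i j x = 6 - b + 5" "w5_dist i j x = 6 - b" using 3 Vv b by auto
      then show ?thesis using w5 relpow_trans[OF w5 W50] by metis
    qed
  qed
  then show "(x, Wv 0) \<in> ?E ^^ w0_dist i j x" "(x, Wv 5) \<in> ?E ^^ w5_dist i j x" by auto
qed

text \<open>The formula is the length of an actual walk: along the common segment if there is one, and otherwise the
  concatenation of the walks from both vertices to the better hub.\<close>

lemma walk_cut_dist:
  assumes x: "x \<in> B_verts k" "x \<noteq> Vv i j" and y: "y \<in> B_verts k" "y \<noteq> Vv i j"
    and j: "j \<in> {1..5}"
  shows "(x, y) \<in> arcs_ends (Bdel k i j) ^^ cut_dist i j x y"
proof -
  let ?E = "arcs_ends (Bdel k i j)"
  show ?thesis
  proof (cases "seg_dist i j x y")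
    case None
    have "(x, y) \<in> ?E ^^ (w0_dist i j x + w0_dist i j y)"
      using walk_to_hubs(1)[OF x j] walk_to_hubs(1)[OF y j]
      by (blast intro: relpow_trans sym_relpow[OF sym_ends_Bdel])
    moreover have "(x, y) \<in> ?E ^^ (w5_dist i j x + w5_dist i j y)"
      using walk_to_hubs(2)[OF x j] walk_to_hubs(2)[OF y j]
      by (blast intro: relpow_trans sym_relpow[OF sym_ends_Bdel])
    ultimately show ?thesis using None by (simp add: cut_dist_def min_def)
  next
    case (Some d)
    then consider a b where "x = Wv a" "y = Wv b" "d = (a - b) + (b - a)"
      | q a b where "x = Vv q a" "y = Vv q b" "q = i \<Longrightarrow> (a < j) = (b < j)" "d = (a - b) + (b - a)"
      by (cases x; cases y) (auto split: if_splits)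
    then have "(x, y) \<in> ?E ^^ d"
    proof cases
      case (1 a b)
      then have "a \<le> 5" "b \<le> 5" using x y by (auto simp: B_verts_def)
      then show ?thesis
        using 1 walk_W[of a "b - a" k i j] walk_W[of b "a - b" k i j] sym_relpow[OF sym_ends_Bdel]
        by (cases "a \<le> b") auto
    next
      case (2 q a b)
      then have ab: "q \<in> {1..k}" "a \<in> {1..5}" "b \<in> {1..5}" "q = i \<Longrightarrow> a \<noteq> j" "q = i \<Longrightarrow> b \<noteq> j"
        using x y by (auto simp: B_verts_def)
      show ?thesis
      proof (cases "a \<le> b")
        case True
        with 2 ab have "(Vv q a, Vv q (a + (b - a))) \<in> ?E ^^ (b - a)"
          by (intro walk_V) auto
        with True 2 show ?thesis by simp
      next
        case False
        with 2 ab have "(Vv q b, Vv q (b + (a - b))) \<in> ?E ^^ (a - b)"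
          by (intro walk_V) auto
        with False 2 show ?thesis using sym_relpow[OF sym_ends_Bdel] by auto
      qed
    qed
    then show ?thesis using Some by (simp add: cut_dist_def)
  qed
qed

section \<open>Distances and Wiener index after a deletion\<close>

lemma gdist_Bdel:
  assumes x: "x \<in> B_verts k" "x \<noteq> Vv i j" and y: "y \<in> B_verts k" "y \<noteq> Vv i j"
    and j: "j \<in> {1..5}"
  shows "gdist (Bdel k i j) x y = cut_dist i j x y"
proof -
  interpret wf_digraph "Bdel k i j" by (rule wf_Bdel)
  have j': "1 \<le> j" "j \<le> 5" using j by auto
  show ?thesis
  proof (rule gdist_eqI[where D = "cut_dist i j x"])
    show "x \<in> verts (Bdel k i j)" using x by (simp add: verts_Bdel)
    show "cut_dist i j x x = 0" by (cases x) (simp_all add: cut_dist_def)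
    show "cut_dist i j x v \<le> Suc (cut_dist i j x u)" if "u \<rightarrow>\<^bsub>Bdel k i j\<^esub> v" for u v
    proof -
      have uv: "u \<noteq> Vv i j" "v \<noteq> Vv i j" "(u, v) \<in> B_half k \<or> (v, u) \<in> B_half k"
        using that by (simp_all add: ends_Bdel)
      show ?thesis
        using uv(3) cut_dist_half[OF j' _ uv(1,2) x] cut_dist_half[OF j' _ uv(2,1) x] by blast
    qed
    show "(x, y) \<in> arcs_ends (Bdel k i j) ^^ cut_dist i j x y"
      by (rule walk_cut_dist[OF x y j])
  qed
qed

lemma connected_Bdel:
  assumes j: "j \<in> {1..5}"
  shows "Digraph_Component.connected (Bdel k i j)"
proof -
  interpret wf_digraph "Bdel k i j" by (rule wf_Bdel)
  show ?thesis
  proof (rule connectedI)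
    have "Wv 0 \<in> verts (Bdel k i j)" by (auto simp: verts_Bdel B_verts_def)
    then show "verts (Bdel k i j) \<noteq> {}" by blast
  next
    fix x y assume "x \<in> verts (Bdel k i j)" and y: "y \<in> verts (Bdel k i j)"
    moreover have "(x, y) \<in> arcs_ends (Bdel k i j) ^^ cut_dist i j x y"
      using calculation j by (intro walk_cut_dist) (auto simp: verts_Bdel)
    ultimately obtain p where "awalk x p y" using awalk_of_relpow by blast
    then show "x \<rightarrow>\<^sup>*\<^bsub>mk_symmetric (Bdel k i j)\<^esub> y"
      by (intro reachable_mk_symmetricI reachable_awalkI)
  qed
qed

lemma Bdel_0: "Bdel k 0 j = with_proj (B k)"
proof -
  have "Vv 0 j \<notin> B_verts k" by (auto simp: B_verts_def)
  moreover have "fst e \<noteq> Vv 0 j \<and> snd e \<noteq> Vv 0 j" if "e \<in> parcs (B k)" for e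
    using that by (auto simp: B_def B_half_def)
  ultimately show ?thesis
    by (auto simp: Bdel_def pre_digraph.del_vert_def B_def with_proj_def)
qed

text \<open>Summing over all of \<^term>\<open>B_verts k\<close>, with zeros for the deleted vertex, lets the Wiener indices before
  and after the deletion be subtracted term by term.\<close>

lemma wiener_Bdel:
  assumes j: "j \<in> {1..5}"
  shows "wiener (Bdel k i j) = 1/2 * (\<Sum>x\<in>B_verts k. \<Sum>y\<in>B_verts k.
    if x = Vv i j \<or> y = Vv i j then 0 else real (cut_dist i j x y))"
proof -
  let ?V = "B_verts k" and ?v = "Vv i j"
  let ?f = "\<lambda>x y. if x = ?v \<or> y = ?v then 0 else real (cut_dist i j x y)"
  have diag: "cut_dist i j x x = 0" for x by (cases x) (simp_all add: cut_dist_def)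
  have "(\<Sum>x\<in>?V. \<Sum>y\<in>?V. ?f x y) = (\<Sum>(x, y)\<in>?V \<times> ?V. ?f x y)"
    by (simp add: sum.cartesian_product)
  also have "\<dots> = (\<Sum>(x, y) \<in> {(x, y). x \<in> ?V - {?v} \<and> y \<in> ?V - {?v} \<and> x \<noteq> y}. real (gdist (Bdel k i j) x y))"
    by (rule sum.mono_neutral_cong_right)
      (auto simp: finite_B_verts diag gdist_Bdel[OF _ _ _ _ j] split: if_splits)
  finally show ?thesis by (simp add: wiener_def verts_Bdel)
qed

definition dist_loss :: "nat \<Rightarrow> nat \<Rightarrow> bvertex \<Rightarrow> bvertex \<Rightarrow> real" where
  "dist_loss i j x y = real (cut_dist 0 1 x y) -
     (if x = Vv i j \<or> y = Vv i j then 0 else real (cut_dist i j x y))"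

lemma wiener_diff:
  assumes "j \<in> {1..5}"
  shows "wiener (with_proj (B k)) - wiener (Bdel k i j) =
    1/2 * (\<Sum>x\<in>B_verts k. \<Sum>y\<in>B_verts k. dist_loss i j x y)"
proof -
  have "wiener (with_proj (B k)) = 1/2 * (\<Sum>x\<in>B_verts k. \<Sum>y\<in>B_verts k. real (cut_dist 0 1 x y))"
    unfolding Bdel_0[of k 1, symmetric] using wiener_Bdel[of 1 k 0]
    by (auto simp: B_verts_def intro!: sum.cong)
  then show ?thesis
    by (simp add: wiener_Bdel[OF assms] dist_loss_def sum_subtractf field_simps)
qed

text \<open>This is applied with \<open>P\<close> the detour that loses a vertex, since distances off this detour are unaffected.\<close>

lemma sum_symmetric_split:
  fixes g :: "'a \<Rightarrow> 'a \<Rightarrow> real"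
  assumes "finite P" "finite Q" "P \<inter> Q = {}"
    and sym: "\<And>x y. g x y = g y x" and zero: "\<And>x y. x \<in> Q \<Longrightarrow> y \<in> Q \<Longrightarrow> g x y = 0"
  shows "(\<Sum>x\<in>P \<union> Q. \<Sum>y\<in>P \<union> Q. g x y) = (\<Sum>x\<in>P. (\<Sum>y\<in>P. g x y) + 2 * (\<Sum>y\<in>Q. g x y))"
proof -
  have "(\<Sum>x\<in>Q. \<Sum>y\<in>P. g x y) = (\<Sum>x\<in>P. \<Sum>y\<in>Q. g x y)"
    by (subst sum.swap) (simp add: sym)
  moreover have "(\<Sum>x\<in>Q. \<Sum>y\<in>Q. g x y) = 0" using zero by simp
  ultimately show ?thesis
    using assms(1-3) by (simp add: sum.union_disjoint sum.distrib sum_distrib_left)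
qed

lemma cut_dist_commute: "cut_dist i j x y = cut_dist i j y x"
proof -
  have "seg_dist i j x y = seg_dist i j y x"
    by (cases x; cases y) auto
  then show ?thesis
    by (simp only: cut_dist_def add.commute[of "w0_dist i j x"] add.commute[of "w5_dist i j x"])
qed

lemma dist_loss_commute: "dist_loss i j x y = dist_loss i j y x"
  by (auto simp: dist_loss_def cut_dist_commute)

definition other_verts :: "nat \<Rightarrow> nat \<Rightarrow> bvertex set" where
  "other_verts k i = Wv ` {..5} \<union> case_prod Vv ` (({1..k} - {i}) \<times> {1..5})"

text \<open>The other detours are interchangeable, so they contribute \<open>k - 1\<close> times the same amount. This is where the
  dependence on \<open>k\<close> becomes linear.\<close>

lemma sum_other_verts:
  fixes f :: "bvertex \<Rightarrow> real"
  assumes i: "i \<in> {1..k}" and f: "\<And>q b. q \<noteq> i \<Longrightarrow> 1 \<le> q \<Longrightarrow> f (Vv q b) = h b"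
  shows "(\<Sum>y\<in>other_verts k i. f y) = (\<Sum>c\<le>5. f (Wv c)) + (real k - 1) * (\<Sum>b=1..5. h b)"
proof -
  have "(\<Sum>y\<in>case_prod Vv ` (({1..k} - {i}) \<times> {1..5}). f y) = (\<Sum>(q, b)\<in>({1..k} - {i}) \<times> {1..5}. f (Vv q b))"
    by (subst sum.reindex) (auto simp: inj_on_def case_prod_beta)
  also have "\<dots> = (\<Sum>q\<in>{1..k} - {i}. \<Sum>b=1..5. h b)"
    unfolding sum.cartesian_product[symmetric] using f by (intro sum.cong) auto
  also have "\<dots> = (real k - 1) * (\<Sum>b=1..5. h b)"
    using i by (simp add: card_Diff_singleton of_nat_diff)
  finally show ?thesis
    unfolding other_verts_def
    by (subst sum.union_disjoint) (auto simp: sum.reindex inj_on_def)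
qed

lemma wiener_diff_path:
  assumes i: "i \<in> {1..k}" and j: "j \<in> {1..5}"
    and h: "\<And>a q b. q \<noteq> i \<Longrightarrow> 1 \<le> q \<Longrightarrow> dist_loss i j (Vv i a) (Vv q b) = h a b"
  shows "wiener (with_proj (B k)) - wiener (Bdel k i j) =
    (\<Sum>a=1..5. \<Sum>b=1..5. dist_loss i j (Vv i a) (Vv i b)) / 2
    + (\<Sum>a=1..5. \<Sum>c\<le>5. dist_loss i j (Vv i a) (Wv c))
    + (real k - 1) * (\<Sum>a=1..5. \<Sum>b=1..5. h a b)"
proof -
  let ?P = "Vv i ` {1..5}" and ?Q = "other_verts k i"
  have V: "B_verts k = ?P \<union> ?Q"
    using i by (auto simp: B_verts_def other_verts_def)
  have zero: "dist_loss i j x y = 0" if "x \<in> ?Q" "y \<in> ?Q" for x y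
  proof -
    have off_path: "(\<exists>c. z = Wv c) \<or> (\<exists>q b. z = Vv q b \<and> q \<noteq> i \<and> q \<noteq> 0)" if "z \<in> ?Q" for z
      using that by (auto simp: other_verts_def)
    show ?thesis
      using off_path[OF that(1)] off_path[OF that(2)]
      by (elim disjE exE conjE) (simp_all add: dist_loss_def cut_dist_def)
  qed
  have Q: "(\<Sum>y\<in>?Q. dist_loss i j (Vv i a) y) =
      (\<Sum>c\<le>5. dist_loss i j (Vv i a) (Wv c)) + (real k - 1) * (\<Sum>b=1..5. h a b)" for a
    by (rule sum_other_verts[OF i]) (rule h)
  have "(\<Sum>x\<in>B_verts k. \<Sum>y\<in>B_verts k. dist_loss i j x y) =
    (\<Sum>x\<in>?P. (\<Sum>y\<in>?P. dist_loss i j x y) + 2 * (\<Sum>y\<in>?Q. dist_loss i j x y))"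
    unfolding V
  proof (rule sum_symmetric_split)
    show "?P \<inter> ?Q = {}" by (auto simp: other_verts_def)
    show "dist_loss i j x y = dist_loss i j y x" for x y by (rule dist_loss_commute)
  qed (simp_all add: zero other_verts_def)
  also have "\<dots> = (\<Sum>a=1..5. (\<Sum>b=1..5. dist_loss i j (Vv i a) (Vv i b))
     + 2 * ((\<Sum>c\<le>5. dist_loss i j (Vv i a) (Wv c)) + (real k - 1) * (\<Sum>b=1..5. h a b)))"
    by (simp add: sum.reindex inj_on_def Q)
  finally show ?thesis
    unfolding wiener_diff[OF j] by (simp add: sum.distrib sum_distrib_left field_simps)
qed

text \<open>The value at \<open>k = 1\<close> is zero, as \<^term>\<open>B 1\<close> is the cycle of length 11, in which
  all vertices are good; so only the multiple of \<open>k - 1\<close> survives.\<close>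

lemma wiener_diff_value:
  assumes i: "i \<in> {1..k}" and j: "j \<in> {1..5}"
  shows "wiener (with_proj (B k)) - wiener (Bdel k i j) =
    (real k - 1) * (if j = 3 then 20 else if j = 2 \<or> j = 4 then 15 else 0)"
proof -
  \<comment> \<open>The loss of distance between position a of the cut detour and
    position b of another one: the route is through the better hub before the deletion,
    and after it through the hub at which the tail hangs
    (the other branch of each minimum is the longer one).\<close>
  define h where "h a b = real (min (a + b) (6 - a + (6 - b))) -
    (if a = j then 0 else if a < j then real (min (a + b) (5 + a + (6 - b)))
     else real (min (11 - a + b) (6 - a + (6 - b))))" for a b
  have i0: "i \<noteq> 0" using i by auto
  have h: "dist_loss i j (Vv i a) (Vv q b) = h a b" if "q \<noteq> i" "1 \<le> q" for a q b
    using that i0 by (auto simp: dist_loss_def cut_dist_def h_def)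
  have S: "(\<Sum>a=1..5. f a) = f 1 + f 2 + f 3 + f 4 + f 5"
    "(\<Sum>a\<le>5. f a) = f 0 + f 1 + f 2 + f 3 + f 4 + f 5" for f :: "nat \<Rightarrow> real"
    by (simp_all add: numeral_eq_Suc)
  have eq: "wiener (with_proj (B k)) - wiener (Bdel k i j) =
    (\<Sum>a=1..5. \<Sum>b=1..5. dist_loss i j (Vv i a) (Vv i b)) / 2
    + (\<Sum>a=1..5. \<Sum>c\<le>5. dist_loss i j (Vv i a) (Wv c))
    + (real k - 1) * (\<Sum>a=1..5. \<Sum>b=1..5. h a b)"
    by (rule wiener_diff_path[OF i j]) (rule h)
  consider "j = 1" | "j = 2" | "j = 3" | "j = 4" | "j = 5" using j by force
  then show ?thesis
    unfolding eq S
    by cases (simp_all add: dist_loss_def cut_dist_def h_def i0)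
qed

section \<open>Counting the good vertices\<close>

lemma good_path_vertex_iff:
  assumes i: "i \<in> {1..k}" and j: "j \<in> {1..5}" and k: "2 \<le> k"
  shows "good_vertex (with_proj (B k)) (Vv i j) \<longleftrightarrow> j = 1 \<or> j = 5"
proof -
  have "Vv i j \<in> verts (with_proj (B k))" using i j by (auto simp: B_def B_verts_def)
  then have "good_vertex (with_proj (B k)) (Vv i j) \<longleftrightarrow>
      wiener (with_proj (B k)) - wiener (Bdel k i j) = 0"
    using connected_Bdel[OF j] by (simp add: good_vertex_def Bdel_def)
  also have "\<dots> \<longleftrightarrow> j = 1 \<or> j = 5"
    unfolding wiener_diff_value[OF i j] using k j by auto
  finally show ?thesis .
qed

text \<open>The six vertices of the short path may or may not be good; they only account for the gap between the bounds.\<close>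

lemma card_good_bounds:
  assumes k: "2 \<le> k"
  shows "2 * k \<le> card {v. good_vertex (with_proj (B k)) v}"
    and "card {v. good_vertex (with_proj (B k)) v} \<le> 2 * k + 6"
proof -
  let ?S = "{v. good_vertex (with_proj (B k)) v}"
  let ?E = "case_prod Vv ` ({1..k} \<times> {1, 5})"
  have E: "card ?E = 2 * k"
    by (subst card_image) (auto simp: inj_on_def)
  have "?E \<subseteq> ?S" using good_path_vertex_iff[OF _ _ k] by auto
  moreover have sub: "?S \<subseteq> ?E \<union> Wv ` {..5}"
  proof
    fix v assume v: "v \<in> ?S"
    then have V: "v \<in> B_verts k" by (auto simp: good_vertex_def B_def)
    show "v \<in> ?E \<union> Wv ` {..5}"
    proof (cases v)
      case (Vv i j)
      then have "i \<in> {1..k}" "j \<in> {1..5}" using V by (auto simp: B_verts_def)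
      then show ?thesis using v Vv good_path_vertex_iff[OF _ _ k] by auto
    qed (use V in \<open>auto simp: B_verts_def\<close>)
  qed
  ultimately show "2 * k \<le> card ?S"
    using E card_mono[of ?S ?E] finite_subset[OF sub] by auto
  have "card ?S \<le> card (?E \<union> Wv ` {..5})" by (rule card_mono[OF _ sub]) auto
  also have "\<dots> \<le> card ?E + card (Wv ` {..5})" by (rule card_Un_le)
  also have "\<dots> = 2 * k + 6" using E by (simp add: card_image inj_on_def)
  finally show "card ?S \<le> 2 * k + 6" .
qed

theorem corollary1:
  shows "(\<lambda>k. good_proportion (with_proj (B k))) \<longlonglongrightarrow> 2 / 5"
proof (rule tendsto_sandwich)
  have verts: "card (verts (with_proj (B k))) = 5 * k + 6" for k
    by (simp add: B_def card_B_verts)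
  show "\<forall>\<^sub>F k in sequentially. 2 * real k / (5 * real k + 6) \<le> good_proportion (with_proj (B k))"
    using eventually_ge_at_top[of 2]
  proof eventually_elim
    case (elim k)
    have "2 * real k \<le> real (card {v. good_vertex (with_proj (B k)) v})"
      using card_good_bounds(1)[OF elim] by linarith
    then show ?case unfolding good_proportion_def verts by (simp add: divide_right_mono)
  qed
  show "\<forall>\<^sub>F k in sequentially. good_proportion (with_proj (B k)) \<le> (2 * real k + 6) / (5 * real k + 6)"
    using eventually_ge_at_top[of 2]
  proof eventually_elim
    case (elim k)
    have "real (card {v. good_vertex (with_proj (B k)) v}) \<le> 2 * real k + 6"
      using card_good_bounds(2)[OF elim] by linarith
    then show ?case unfolding good_proportion_def verts by (simp add: divide_right_mono)
  qed
  show "(\<lambda>k. 2 * real k / (5 * real k + 6)) \<longlonglongrightarrow> 2 / 5" by real_asymp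
  show "(\<lambda>k. (2 * real k + 6) / (5 * real k + 6)) \<longlonglongrightarrow> 2 / 5" by real_asymp
qed

end
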